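(* Let $\mathcal D$ be a family of bounded, upwards closed dependencies. Then for every formula $\phi\in\mathrm{FO}(\mathcal D)$, every model $M$ and every team $X$ over $M$: if $M\models_X\phi$ then there exists $Y\subseteq X$ with $|Y|\le\mathtt{ht}(\phi)$ such that $M\models_Y\phi$.
   Context: Team semantics: models have domain $\mathrm{dom}(M)$ with at least two elements. A team $X$ over $M$ with domain a finite set of variables $V$ is a set of assignments $s:V\to\mathrm{dom}(M)$; for a tuple $\bar x$ of variables, $X(\bar x)=\{s(\bar x): s\in X\}$. Formulas are in negation normal form, and $M\models_X\phi$ is defined by: for a first-order literal $\alpha$, $M\models_X\alpha$ iff every $s\in X$ satisfies $\alpha$ in the Tarskian sense; $M\models_X\psi\vee\chi$ iff $X=Y\cup Z$ for some $Y,Z$ with $M\models_Y\psi$ and $M\models_Z\chi$; $M\models_X\psi\wedge\chi$ iff both hold on $X$; $M\models_X\exists v\psi$ iff there is $H:X\to\mathcal P(\mathrm{dom}(M))\setminus\{\emptyset\}$ with $M\models_{X[H/v]}\psi$, where $X[H/v]=\{s[m/v]: s\in X, m\in H(s)\}$; $M\models_X\forall v\psi$ iff $M\models_{X[M/v]}\psi$, where $X[M/v]=\{s[m/v]: s\in X, m\in\mathrm{dom}(M)\}$. A dependency of arity $n$ is a class $\mathbf D$ of structures $(\mathrm{dom}(M),R)$, $R$ $n$-ary, closed under isomorphism; $M\models_X\mathbf D\bar x$ iff $(\mathrm{dom}(M),X(\bar x))\in\mathbf D$; $\mathrm{FO}(\mathcal D)$ is first-order logic with all atoms $\mathbf D\bar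 x$, $\mathbf D\in\mathcal D$. $\mathbf D$ is upwards closed if $(\mathrm{dom}(M),R)\in\mathbf D$ and $R\subseteq S$ imply $(\mathrm{dom}(M),S)\in\mathbf D$. For a cardinal $\kappa$, $\mathbf D$ is $\kappa$-bounded if whenever $M\models_X\mathbf D\bar x$ there is $Y\subseteq X$ with $|Y|\le\kappa$ and $M\models_Y\mathbf D\bar x$; $\mathbf D$ is bounded if it is $\kappa$-bounded for some cardinal $\kappa$. Height: $\mathtt{ht}(\alpha)=0$ for first-order literals $\alpha$; $\mathtt{ht}(\mathbf D\bar x)$ is the least cardinal $\kappa$ such that $\mathbf D$ is $\kappa$-bounded; $\mathtt{ht}(\psi_1\vee\psi_2)=\mathtt{ht}(\psi_1\wedge\psi_2)=\mathtt{ht}(\psi_1)+\mathtt{ht}(\psi_2)$ (cardinal addition); $\mathtt{ht}(\exists v\psi)=\mathtt{ht}(\forall v\psi)=\mathtt{ht}(\psi)$. *)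

theory Defs
  imports Main "HOL-Library.Infinite_Typeclass"
begin

unbundle cardinal_syntax

section \<open>Formulas and models\<close>

text \<open>
  A function or relation symbol is identified by its name together with the number of arguments
  it is applied to, so the types of names \<open>'f\<close> and \<open>'p\<close> cover every vocabulary.
\<close>

datatype 'f trm = Var nat | Fun 'f "'f trm list"

datatype ('f, 'p) atom = Eq "'f trm" "'f trm" | Rel 'p "'f trm list"

datatype ('f, 'p) literal = Pos "('f, 'p) atom" | Neg "('f, 'p) atom"

text \<open>
  Domains are subsets of a type \<open>'u\<close>, which plays the role of the universe of sets: a class of
  structures is a set of pairs of a domain and a set of tuples (lists) over it.
\<close>

record 'u dependency =
  arity :: nat
  structures :: "('u set \<times> 'u list set) set"

datatype ('f, 'p, 'u) formula =
    Lit "('f, 'p) literal"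
  | Dep "'u dependency" "nat list"
  | Or "('f, 'p, 'u) formula" "('f, 'p, 'u) formula"
  | And "('f, 'p, 'u) formula" "('f, 'p, 'u) formula"
  | Ex nat "('f, 'p, 'u) formula"
  | All nat "('f, 'p, 'u) formula"

primrec trm_vars :: "'f trm \<Rightarrow> nat set" where
  "trm_vars (Var x) = {x}"
| "trm_vars (Fun f ts) = \<Union> (set (map trm_vars ts))"

primrec atom_vars :: "('f, 'p) atom \<Rightarrow> nat set" where
  "atom_vars (Eq t u) = trm_vars t \<union> trm_vars u"
| "atom_vars (Rel p ts) = \<Union> (trm_vars ` set ts)"

primrec literal_vars :: "('f, 'p) literal \<Rightarrow> nat set" where
  "literal_vars (Pos a) = atom_vars a"
| "literal_vars (Neg a) = atom_vars a"

primrec free_vars :: "('f, 'p, 'u) formula \<Rightarrow> nat set" where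
  "free_vars (Lit l) = literal_vars l"
| "free_vars (Dep D xs) = set xs"
| "free_vars (Or \<psi> \<chi>) = free_vars \<psi> \<union> free_vars \<chi>"
| "free_vars (And \<psi> \<chi>) = free_vars \<psi> \<union> free_vars \<chi>"
| "free_vars (Ex v \<psi>) = free_vars \<psi> - {v}"
| "free_vars (All v \<psi>) = free_vars \<psi> - {v}"

inductive_set FO :: "'u dependency set \<Rightarrow> ('f, 'p, 'u) formula set" for \<D> where
  "Lit l \<in> FO \<D>"
| "D \<in> \<D> \<Longrightarrow> length xs = arity D \<Longrightarrow> Dep D xs \<in> FO \<D>"
| "\<psi> \<in> FO \<D> \<Longrightarrow> \<chi> \<in> FO \<D> \<Longrightarrow> Or \<psi> \<chi> \<in> FO \<D>"
| "\<psi> \<in> FO \<D> \<Longrightarrow> \<chi> \<in> FO \<D> \<Longrightarrow> And \<psi> \<chi> \<in> FO \<D>"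
| "\<psi> \<in> FO \<D> \<Longrightarrow> Ex v \<psi> \<in> FO \<D>"
| "\<psi> \<in> FO \<D> \<Longrightarrow> All v \<psi> \<in> FO \<D>"

record ('f, 'p, 'u) model =
  Dom :: "'u set"
  fun_interp :: "'f \<Rightarrow> 'u list \<Rightarrow> 'u"
  rel_interp :: "'p \<Rightarrow> 'u list \<Rightarrow> bool"

definition is_domain :: "'u set \<Rightarrow> bool" where
  "is_domain A \<longleftrightarrow> (\<exists>a\<in>A. \<exists>b\<in>A. a \<noteq> b)"

definition is_model :: "('f, 'p, 'u) model \<Rightarrow> bool" where
  "is_model M \<longleftrightarrow> is_domain (Dom M) \<and>
     (\<forall>f as. set as \<subseteq> Dom M \<longrightarrow> fun_interp M f as \<in> Dom M)"


section \<open>Teams and team semantics\<close>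

text \<open>An assignment with domain \<open>V\<close> is a partial map that is defined exactly on \<open>V\<close>.\<close>

type_synonym 'u assignment = "nat \<rightharpoonup> 'u"

definition is_team :: "'u set \<Rightarrow> nat set \<Rightarrow> 'u assignment set \<Rightarrow> bool" where
  "is_team A V X \<longleftrightarrow> finite V \<and> (\<forall>s\<in>X. dom s = V \<and> ran s \<subseteq> A)"

definition team_rel :: "'u assignment set \<Rightarrow> nat list \<Rightarrow> 'u list set" where
  "team_rel X xs = {map (\<lambda>x. the (s x)) xs | s. s \<in> X}"

definition supplement ::
    "'u assignment set \<Rightarrow> ('u assignment \<Rightarrow> 'u set) \<Rightarrow> nat \<Rightarrow> 'u assignment set" where
  "supplement X H v = {s(v \<mapsto> m) | s m. s \<in> X \<and> m \<in> H s}"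

definition duplicate :: "'u assignment set \<Rightarrow> 'u set \<Rightarrow> nat \<Rightarrow> 'u assignment set" where
  "duplicate X A v = {s(v \<mapsto> m) | s m. s \<in> X \<and> m \<in> A}"

primrec trm_val :: "('f, 'p, 'u) model \<Rightarrow> 'u assignment \<Rightarrow> 'f trm \<Rightarrow> 'u" where
  "trm_val M s (Var x) = the (s x)"
| "trm_val M s (Fun f ts) = fun_interp M f (map (trm_val M s) ts)"

primrec atom_holds :: "('f, 'p, 'u) model \<Rightarrow> 'u assignment \<Rightarrow> ('f, 'p) atom \<Rightarrow> bool" where
  "atom_holds M s (Eq t u) \<longleftrightarrow> trm_val M s t = trm_val M s u"
| "atom_holds M s (Rel p ts) \<longleftrightarrow> rel_interp M p (map (trm_val M s) ts)"

primrec literal_holds :: "('f, 'p, 'u) model \<Rightarrow> 'u assignment \<Rightarrow> ('f, 'p) literal \<Rightarrow> bool" where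
  "literal_holds M s (Pos a) \<longleftrightarrow> atom_holds M s a"
| "literal_holds M s (Neg a) \<longleftrightarrow> \<not> atom_holds M s a"

definition dep_holds :: "'u set \<Rightarrow> 'u assignment set \<Rightarrow> 'u dependency \<Rightarrow> nat list \<Rightarrow> bool" where
  "dep_holds A X D xs \<longleftrightarrow> (A, team_rel X xs) \<in> structures D"

primrec sat :: "('f, 'p, 'u) model \<Rightarrow> 'u assignment set \<Rightarrow> ('f, 'p, 'u) formula \<Rightarrow> bool" where
  "sat M X (Lit l) \<longleftrightarrow> (\<forall>s\<in>X. literal_holds M s l)"
| "sat M X (Dep D xs) \<longleftrightarrow> dep_holds (Dom M) X D xs"
| "sat M X (Or \<psi> \<chi>) \<longleftrightarrow> (\<exists>Y Z. X = Y \<union> Z \<and> sat M Y \<psi> \<and> sat M Z \<chi>)"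
| "sat M X (And \<psi> \<chi>) \<longleftrightarrow> sat M X \<psi> \<and> sat M X \<chi>"
| "sat M X (Ex v \<psi>) \<longleftrightarrow>
     (\<exists>H. (\<forall>s\<in>X. H s \<noteq> {} \<and> H s \<subseteq> Dom M) \<and> sat M (supplement X H v) \<psi>)"
| "sat M X (All v \<psi>) \<longleftrightarrow> sat M (duplicate X (Dom M) v) \<psi>"


section \<open>Dependencies\<close>

definition is_structure :: "nat \<Rightarrow> 'u set \<Rightarrow> 'u list set \<Rightarrow> bool" where
  "is_structure n A R \<longleftrightarrow> is_domain A \<and> (\<forall>as\<in>R. length as = n \<and> set as \<subseteq> A)"

definition is_dependency :: "'u dependency \<Rightarrow> bool" where
  "is_dependency D \<longleftrightarrow>
     (\<forall>(A, R) \<in> structures D. is_structure (arity D) A R) \<and>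
     (\<forall>(A, R) \<in> structures D. \<forall>B f. bij_betw f A B \<longrightarrow> (B, map f ` R) \<in> structures D)"

definition upwards_closed :: "'u dependency \<Rightarrow> bool" where
  "upwards_closed D \<longleftrightarrow>
     (\<forall>A R S. (A, R) \<in> structures D \<and> R \<subseteq> S \<and> is_structure (arity D) A S
        \<longrightarrow> (A, S) \<in> structures D)"

text \<open>
  A cardinal is a relation \<open>\<kappa>\<close> with \<open>Card_order \<kappa>\<close>, compared by \<open>\<le>o\<close>.
\<close>

definition card_bounded :: "'k rel \<Rightarrow> 'u dependency \<Rightarrow> bool" where
  "card_bounded \<kappa> D \<longleftrightarrow>
     (\<forall>A V X xs. is_domain A \<and> is_team A V X \<and> set xs \<subseteq> V \<and> length xs = arity D \<and>
        dep_holds A X D xs \<longrightarrow> (\<exists>Y\<subseteq>X. |Y| \<le>o \<kappa> \<and> dep_holds A Y D xs))"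

text \<open>
  The cardinals that may serve as bounds are those carried by a type \<open>'k\<close>, which is independent
  of \<open>'u\<close>. If they were taken over \<open>'u list\<close>, every dependency would be bounded, because every
  structure is a set inside the types \<open>'u\<close> and \<open>'u list\<close>. Infinity of \<open>'k\<close> ensures that
  these cardinals are closed under addition.
\<close>

definition bounded :: "'k::infinite itself \<Rightarrow> 'u dependency \<Rightarrow> bool" where
  "bounded _ D \<longleftrightarrow> (\<exists>\<kappa>::'k rel. Card_order \<kappa> \<and> card_bounded \<kappa> D)"


section \<open>Height\<close>

text \<open>
  Cardinals are determined only up to \<open>=o\<close>, so the choices below are immaterial.
  The library sum \<open>+c\<close> lives on a sum type; \<open>cadd\<close> is a copy of it on \<open>'k\<close>.
\<close>

definition cadd :: "'k::infinite rel \<Rightarrow> 'k rel \<Rightarrow> 'k rel" where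
  "cadd \<kappa> \<mu> = (SOME \<nu>. Card_order \<nu> \<and> \<nu> =o \<kappa> +c \<mu>)"

definition dep_height :: "'u dependency \<Rightarrow> 'k::infinite rel" where
  "dep_height D = (SOME \<kappa>. Card_order \<kappa> \<and> card_bounded \<kappa> D \<and>
     (\<forall>\<mu>::'k rel. Card_order \<mu> \<and> card_bounded \<mu> D \<longrightarrow> \<kappa> \<le>o \<mu>))"

primrec height :: "('f, 'p, 'u) formula \<Rightarrow> 'k::infinite rel" where
  "height (Lit l) = |{}|"
| "height (Dep D xs) = dep_height D"
| "height (Or \<psi> \<chi>) = cadd (height \<psi>) (height \<chi>)"
| "height (And \<psi> \<chi>) = cadd (height \<psi>) (height \<chi>)"
| "height (Ex v \<psi>) = height \<psi>"
| "height (All v \<psi>) = height \<psi>"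

lemma card_of_type_copy:
  assumes "|A| \<le>o |UNIV :: 'k set|"
  shows "\<exists>B :: 'k set. |A| =o |B|"
proof -
  from assms obtain f :: "_ \<Rightarrow> 'k" where "inj_on f A"
    using card_of_ordLeq[of A "UNIV :: 'k set"] by blast
  then have "bij_betw f A (f ` A)" by (rule inj_on_imp_bij_betw)
  then show ?thesis using card_of_ordIsoI by blast
qed

lemma cadd_csum:
  fixes \<kappa> \<mu> :: "'k::infinite rel"
  assumes "Card_order \<kappa>" "Card_order \<mu>"
  shows "Card_order (cadd \<kappa> \<mu>)" "cadd \<kappa> \<mu> =o \<kappa> +c \<mu>"
proof -
  let ?U = "UNIV :: 'k set"
  have inf: "infinite ?U" by (rule infinite_UNIV)
  have "|Field \<kappa> <+> Field \<mu>| \<le>o |?U <+> ?U|"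
    by (rule card_of_mono1) auto
  also have "|?U <+> ?U| =o |?U|"
    using card_of_Plus_infinite1[OF inf ordIso_imp_ordLeq[OF card_of_refl]] .
  finally have "|Field \<kappa> <+> Field \<mu>| \<le>o |?U|" .
  then obtain B :: "'k set" where "|Field \<kappa> <+> Field \<mu>| =o |B|"
    using card_of_type_copy by blast
  then have "Card_order |B| \<and> |B| =o \<kappa> +c \<mu>"
    unfolding csum_def using ordIso_symmetric card_of_Card_order by blast
  then have "Card_order (cadd \<kappa> \<mu>) \<and> cadd \<kappa> \<mu> =o \<kappa> +c \<mu>"
    unfolding cadd_def by (rule someI)
  then show "Card_order (cadd \<kappa> \<mu>)" "cadd \<kappa> \<mu> =o \<kappa> +c \<mu>" by auto
qed

lemma card_bounded_mono:
  assumes "card_bounded \<mu> D" "\<mu> \<le>o \<kappa>"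
  shows "card_bounded \<kappa> D"
  unfolding card_bounded_def
proof (intro allI impI)
  fix A V X xs
  assume "is_domain A \<and> is_team A V X \<and> set xs \<subseteq> V \<and> length xs = arity D \<and> dep_holds A X D xs"
  with assms(1) obtain Y where Y: "Y \<subseteq> X" "|Y| \<le>o \<mu>" "dep_holds A Y D xs"
    unfolding card_bounded_def by meson
  then show "\<exists>Y\<subseteq>X. |Y| \<le>o \<kappa> \<and> dep_holds A Y D xs"
    using ordLeq_transitive[OF Y(2) assms(2)] by blast
qed

text \<open>
  For a bounded dependency the height is least among the cardinals of every type, not only
  among those on \<open>'k\<close>.
\<close>

lemma dep_height_least:
  fixes D :: "'u dependency"
  assumes "bounded TYPE('k::infinite) D"
  defines "\<kappa> \<equiv> dep_height D :: 'k rel"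
  shows "Card_order \<kappa>" "card_bounded \<kappa> D"
    "\<And>\<mu> :: 'm rel. Card_order \<mu> \<Longrightarrow> card_bounded \<mu> D \<Longrightarrow> \<kappa> \<le>o \<mu>"
proof -
  let ?R = "{\<kappa>::'k rel. Card_order \<kappa> \<and> card_bounded \<kappa> D}"
  have "?R \<noteq> {}" using assms(1) unfolding bounded_def by blast
  moreover have "\<forall>r\<in>?R. Card_order r" by simp
  ultimately have "\<exists>r\<in>?R. \<forall>r'\<in>?R. r \<le>o r'"
    by (rule exists_minim_Card_order)
  then have "\<exists>\<kappa>::'k rel. Card_order \<kappa> \<and> card_bounded \<kappa> D \<and>
     (\<forall>\<mu>::'k rel. Card_order \<mu> \<and> card_bounded \<mu> D \<longrightarrow> \<kappa> \<le>o \<mu>)" by blast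
  from someI_ex[OF this]
  have *: "Card_order \<kappa> \<and> card_bounded \<kappa> D \<and>
     (\<forall>\<mu>::'k rel. Card_order \<mu> \<and> card_bounded \<mu> D \<longrightarrow> \<kappa> \<le>o \<mu>)"
    unfolding \<kappa>_def dep_height_def .
  then show c: "Card_order \<kappa>" and "card_bounded \<kappa> D" by auto
  fix \<mu> :: "'m rel"
  assume \<mu>: "Card_order \<mu>" "card_bounded \<mu> D"
  show "\<kappa> \<le>o \<mu>"
  proof (rule ccontr)
    assume "\<not> \<kappa> \<le>o \<mu>"
    then have "\<mu> <o \<kappa>" using c \<mu>(1)
      using not_ordLeq_iff_ordLess[of \<mu> \<kappa>] unfolding card_order_on_def by blast
    then have le: "\<mu> \<le>o \<kappa>" by (rule ordLess_imp_ordLeq)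
    have f: "|Field \<mu>| =o \<mu>" using \<mu>(1) by (rule card_of_Field_ordIso)
    have "|Field \<mu>| \<le>o |UNIV :: 'k set|"
    proof -
      have "|Field \<mu>| \<le>o \<kappa>" by (rule ordIso_ordLeq_trans[OF f le])
      also have "\<kappa> =o |Field \<kappa>|"
        by (rule ordIso_symmetric[OF card_of_Field_ordIso[OF c]])
      also have "|Field \<kappa>| \<le>o |UNIV :: 'k set|" by (rule card_of_mono1) simp
      finally show ?thesis .
    qed
    then obtain B :: "'k set" where "|Field \<mu>| =o |B|"
      using card_of_type_copy by blast
    then have b: "|B| =o \<mu>"
      using f ordIso_symmetric ordIso_transitive by blast
    have "card_bounded (card_of B) D"
      by (rule card_bounded_mono[OF \<mu>(2) ordIso_imp_ordLeq[OF ordIso_symmetric[OF b]]])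
    then have "\<kappa> \<le>o |B|" using * card_of_Card_order[of B] by blast
    then have "\<kappa> \<le>o \<mu>" by (rule ordLeq_ordIso_trans[OF _ b])
    then show False using \<open>\<not> \<kappa> \<le>o \<mu>\<close> by simp
  qed
qed

end

(*
  The plain statement does not survive conjunction, since satisfaction is neither upwards nor
  downwards closed. It is strengthened: there is Y contained in X with |Y| at most the height
  such that every team between Y and X satisfies the formula. For a disjunction with
  X = A \<union> B, a team Z between Y and X splits as (Z \<inter> A) \<union> (Z \<inter> B); for a
  quantifier, one picks a preimage in X for each member of the small subteam of X[H/v] and keeps
  the same H.
*)
theory Submission
  imports Defs
begin

lemma is_team_subset: "is_team A V X \<Longrightarrow> Y \<subseteq> X \<Longrightarrow> is_team A V Y"
  unfolding is_team_def by (meson subsetD)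

lemma is_team_supplement:
  assumes "is_team A V X" and "\<And>s. s \<in> X \<Longrightarrow> H s \<subseteq> A"
  shows "is_team A (insert v V) (supplement X H v)"
proof -
  have "dom t = insert v V \<and> ran t \<subseteq> A" if t: "t \<in> supplement X H v" for t
  proof -
    obtain s m where sm: "t = s(v \<mapsto> m)" "s \<in> X" "m \<in> H s"
      using t unfolding supplement_def by blast
    have "dom s = V" "ran s \<subseteq> A"
      using assms(1) sm(2) unfolding is_team_def by auto
    moreover have "m \<in> A"
      using assms(2)[OF sm(2)] sm(3) by (rule subsetD)
    ultimately show ?thesis
      using sm(1) by (auto simp: ran_def split: if_splits)
  qed
  then show ?thesis
    using assms(1) unfolding is_team_def by simp
qed

lemma supplement_mono: "X \<subseteq> Y \<Longrightarrow> supplement X H v \<subseteq> supplement Y H v"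
  unfolding supplement_def by blast

text \<open>Lets the universal quantifier reuse everything proved for the existential one, with a
  constant choice function.\<close>

lemma duplicate_eq_supplement: "duplicate X A v = supplement X (\<lambda>_. A) v"
  unfolding duplicate_def supplement_def by simp

text \<open>Choosing one source assignment for each member of \<open>T\<close> gives a function
  \<open>g\<close> on \<open>T\<close>. Its image is the required \<open>Y\<close>, and an image is
  no larger than its domain.\<close>

lemma subset_supplement_small:
  assumes "T \<subseteq> supplement X H v"
  shows "\<exists>Y\<subseteq>X. |Y| \<le>o |T| \<and> T \<subseteq> supplement Y H v"
proof -
  have "\<forall>t\<in>T. \<exists>s\<in>X. \<exists>m\<in>H s. t = s(v \<mapsto> m)"
    using assms unfolding supplement_def by blast
  then obtain g where g: "\<forall>t\<in>T. g t \<in> X \<and> (\<exists>m\<in>H (g t). t = (g t)(v \<mapsto> m))"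
    by metis
  then have "g ` T \<subseteq> X" and "T \<subseteq> supplement (g ` T) H v"
    unfolding supplement_def by blast+
  then show ?thesis
    using card_of_image[of g T] by blast
qed

text \<open>Provides the side condition of \<open>upwards_closed\<close>, which passes only to those
  larger relations that are themselves structures on the domain.\<close>

lemma is_structure_team_rel:
  assumes "is_domain A" "is_team A V X" "set xs \<subseteq> V" "length xs = n"
  shows "is_structure n A (team_rel X xs)"
proof -
  have "the (s x) \<in> A" if "s \<in> X" "x \<in> set xs" for s x
  proof -
    have "x \<in> dom s" "ran s \<subseteq> A"
      using assms(2) that(1) subsetD[OF assms(3) that(2)] unfolding is_team_def by simp_all
    then show ?thesis
      by (auto intro: ranI)
  qed
  then show ?thesis
    using assms(1,4) unfolding is_structure_def team_rel_def by auto
qed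

lemma dep_holds_mono:
  assumes "upwards_closed D" "dep_holds A Y D xs" "Y \<subseteq> Z"
    and "is_domain A" "is_team A V Z" "set xs \<subseteq> V" "length xs = arity D"
  shows "dep_holds A Z D xs"
proof -
  have "team_rel Y xs \<subseteq> team_rel Z xs"
    using assms(3) unfolding team_rel_def by blast
  then show ?thesis
    using assms(1,2) is_structure_team_rel[OF assms(4-7)]
    unfolding upwards_closed_def dep_holds_def by blast
qed

text \<open>The property \<open>P\<close> is left abstract, so that the set-theoretic content of
  each connective can be proved apart from \<open>sat\<close>.\<close>

definition small_core :: "'k rel \<Rightarrow> 'a set \<Rightarrow> ('a set \<Rightarrow> bool) \<Rightarrow> bool" where
  "small_core \<kappa> X P \<longleftrightarrow> (\<exists>Y\<subseteq>X. |Y| \<le>o \<kappa> \<and> (\<forall>Z. Y \<subseteq> Z \<and> Z \<subseteq> X \<longrightarrow> P Z))"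

lemma small_coreI:
  assumes "Y \<subseteq> X" "|Y| \<le>o \<kappa>" "\<And>Z. Y \<subseteq> Z \<Longrightarrow> Z \<subseteq> X \<Longrightarrow> P Z"
  shows "small_core \<kappa> X P"
  unfolding small_core_def using assms by (intro exI[of _ Y]) simp

lemma small_coreE:
  assumes "small_core \<kappa> X P"
  obtains Y where "Y \<subseteq> X" "|Y| \<le>o \<kappa>" "\<And>Z. Y \<subseteq> Z \<Longrightarrow> Z \<subseteq> X \<Longrightarrow> P Z"
proof -
  from assms obtain Y where "Y \<subseteq> X" "|Y| \<le>o \<kappa>" "\<forall>Z. Y \<subseteq> Z \<and> Z \<subseteq> X \<longrightarrow> P Z"
    unfolding small_core_def by (elim exE conjE) (rule that)
  then show thesis
    by (intro that[of Y]) simp_all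
qed

lemma small_core_mono:
  assumes "small_core \<kappa> X P" "\<And>Z. Z \<subseteq> X \<Longrightarrow> P Z \<Longrightarrow> Q Z"
  shows "small_core \<kappa> X Q"
  using assms(1) by (rule small_coreE) (rule small_coreI, assumption+, simp add: assms(2))

text \<open>Since \<open>cadd\<close> is a chosen copy on \<open>'k\<close>, the bound is computed
  with \<open>+c\<close> and then carried over along \<open>=o\<close>.\<close>

lemma card_of_Un_cadd:
  fixes \<kappa> \<mu> :: "'k::infinite rel"
  assumes "Card_order \<kappa>" "Card_order \<mu>" "|A| \<le>o \<kappa>" "|B| \<le>o \<mu>"
  shows "|A \<union> B| \<le>o cadd \<kappa> \<mu>"
proof -
  have "|A \<union> B| \<le>o |A| +c |B|"
    by (rule Un_csum)
  also have "|A| +c |B| \<le>o \<kappa> +c \<mu>"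
    using assms(3,4) by (rule csum_mono)
  also have "\<kappa> +c \<mu> =o cadd \<kappa> \<mu>"
    using cadd_csum(2)[OF assms(1,2)] by (rule ordIso_symmetric)
  finally show ?thesis .
qed

text \<open>The union of the two cores works: if \<open>Z\<close> contains
  \<open>Y1 \<union> Y2\<close>, then \<open>Z \<inter> A\<close> lies between \<open>Y1\<close> and
  \<open>A\<close>, and \<open>Z \<inter> B\<close> between \<open>Y2\<close> and \<open>B\<close>.
  This serves disjunction, and conjunction in the case \<open>A = B\<close>.\<close>

lemma small_core_Un:
  fixes \<kappa> \<mu> :: "'k::infinite rel"
  assumes "Card_order \<kappa>" "Card_order \<mu>" "small_core \<kappa> A P" "small_core \<mu> B Q"
  shows "small_core (cadd \<kappa> \<mu>) (A \<union> B) (\<lambda>Z. P (Z \<inter> A) \<and> Q (Z \<inter> B))"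
proof -
  obtain Y1 where Y1: "Y1 \<subseteq> A" "|Y1| \<le>o \<kappa>" "\<And>Z. Y1 \<subseteq> Z \<Longrightarrow> Z \<subseteq> A \<Longrightarrow> P Z"
    using assms(3) by (rule small_coreE) (rule that)
  obtain Y2 where Y2: "Y2 \<subseteq> B" "|Y2| \<le>o \<mu>" "\<And>Z. Y2 \<subseteq> Z \<Longrightarrow> Z \<subseteq> B \<Longrightarrow> Q Z"
    using assms(4) by (rule small_coreE) (rule that)
  show ?thesis
  proof (rule small_coreI)
    show "Y1 \<union> Y2 \<subseteq> A \<union> B"
      using Y1(1) Y2(1) by (rule Un_mono)
    show "|Y1 \<union> Y2| \<le>o cadd \<kappa> \<mu>"
      using assms(1,2) Y1(2) Y2(2) by (rule card_of_Un_cadd)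
    show "P (Z \<inter> A) \<and> Q (Z \<inter> B)" if "Y1 \<union> Y2 \<subseteq> Z" for Z
      using that Y1(1) Y2(1) by (intro conjI Y1(3) Y2(3)) simp_all
  qed
qed

text \<open>Pulls a core back from the supplemented team. With \<open>H\<close> fixed,
  \<open>supplement\<close> is monotone in the team, so each \<open>Z\<close> between
  \<open>Y\<close> and \<open>X\<close> is sent between \<open>T\<close> and
  \<open>supplement X H v\<close>.\<close>

lemma small_core_supplement:
  assumes "small_core \<kappa> (supplement X H v) P"
  shows "small_core \<kappa> X (\<lambda>Z. P (supplement Z H v))"
proof -
  obtain T where T: "T \<subseteq> supplement X H v" "|T| \<le>o \<kappa>"
    "\<And>Z. T \<subseteq> Z \<Longrightarrow> Z \<subseteq> supplement X H v \<Longrightarrow> P Z"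
    using assms by (rule small_coreE) (rule that)
  obtain Y where Y: "Y \<subseteq> X" "|Y| \<le>o |T|" "T \<subseteq> supplement Y H v"
    using subset_supplement_small[OF T(1)] by blast
  show ?thesis
  proof (rule small_coreI[OF Y(1) ordLeq_transitive[OF Y(2) T(2)]])
    fix Z
    assume "Y \<subseteq> Z" "Z \<subseteq> X"
    then show "P (supplement Z H v)"
      by (intro T(3) subset_trans[OF Y(3)] supplement_mono)
  qed
qed

text \<open>Needed because \<open>cadd\<close> is known to agree with \<open>+c\<close> only on
  cardinal orders. Boundedness enters at the atoms, where it ensures that the choice in
  \<open>dep_height\<close> has a witness.\<close>

lemma Card_order_height:
  assumes "\<And>D. D \<in> \<D> \<Longrightarrow> bounded TYPE('k::infinite) D" and "\<phi> \<in> FO \<D>"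
  shows "Card_order (height \<phi> :: 'k rel)"
  using assms(2)
proof induction
  case (2 D xs)
  then show ?case
    using dep_height_least(1)[OF assms(1)] by simp
qed (simp_all add: cadd_csum(1) card_of_Card_order)

lemma small_core_sat:
  assumes bounded: "\<And>D. D \<in> \<D> \<Longrightarrow> bounded TYPE('k::infinite) D"
    and upwards: "\<And>D. D \<in> \<D> \<Longrightarrow> upwards_closed D"
    and dom: "is_domain (Dom M)"
    and "\<phi> \<in> FO \<D>" "is_team (Dom M) V X" "free_vars \<phi> \<subseteq> V" "sat M X \<phi>"
  shows "small_core (height \<phi> :: 'k rel) X (\<lambda>Z. sat M Z \<phi>)"
  using assms(4-)
\<comment> \<open>Disjunction passes to subteams, and a quantifier enlarges the variable domain to
  \<open>insert v V\<close>, so both must vary.\<close>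
proof (induction arbitrary: V X)
  case (1 l)
  \<comment> \<open>Literals are checked assignment by assignment, hence inherited by every subteam:
    the empty core suffices.\<close>
  show ?case
    by (rule small_coreI[of "{}"]) (use 1(3) in \<open>auto simp: card_of_empty\<close>)
next
  case (2 D xs)
  have "card_bounded (dep_height D :: 'k rel) D"
    using dep_height_least(2)[OF bounded[OF 2(1)]] .
  moreover have "is_domain (Dom M) \<and> is_team (Dom M) V X \<and> set xs \<subseteq> V \<and> length xs = arity D \<and>
      dep_holds (Dom M) X D xs"
    using 2(2-5) dom by simp
  ultimately obtain Y where
    Y: "Y \<subseteq> X" "|Y| \<le>o (dep_height D :: 'k rel)" "dep_holds (Dom M) Y D xs"
    unfolding card_bounded_def by meson
  \<comment> \<open>Boundedness gives the atom on \<open>Y\<close> only; upward closure spreads it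
    to every team between \<open>Y\<close> and \<open>X\<close>.\<close>
  have "dep_holds (Dom M) Z D xs" if "Y \<subseteq> Z" "Z \<subseteq> X" for Z
    using dep_holds_mono[OF upwards[OF 2(1)] Y(3) that(1) dom is_team_subset[OF 2(3) that(2)]]
      2(2,4) by simp
  with Y(1,2) show ?case
    by (simp add: small_coreI)
next
  case (3 \<psi> \<chi>)
  obtain A B where AB: "X = A \<union> B" "sat M A \<psi>" "sat M B \<chi>"
    using 3(7) unfolding sat.simps by (elim exE conjE) (rule that)
  have "A \<subseteq> X" "B \<subseteq> X"
    unfolding AB(1) by (rule Un_upper1, rule Un_upper2)
  note teams = this[THEN is_team_subset[OF 3(5)]]
  have prems: "free_vars \<psi> \<subseteq> V" "free_vars \<chi> \<subseteq> V"
    using 3(6) by simp_all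
  have card: "Card_order (height \<psi> :: 'k rel)" "Card_order (height \<chi> :: 'k rel)"
    by (rule Card_order_height[OF bounded 3(1)], assumption)
      (rule Card_order_height[OF bounded 3(2)])
  note IH = 3(3)[OF teams(1) prems(1) AB(2)] 3(4)[OF teams(2) prems(2) AB(3)]
  have "sat M Z (Or \<psi> \<chi>)" if "Z \<subseteq> A \<union> B" "sat M (Z \<inter> A) \<psi> \<and> sat M (Z \<inter> B) \<chi>" for Z
  proof -
    have "Z = (Z \<inter> A) \<union> (Z \<inter> B)"
      using that(1) by blast
    with that(2) show ?thesis
      unfolding sat.simps by blast
  qed
  with small_core_Un[OF card IH]
  show ?case
    unfolding AB(1) height.simps by (rule small_core_mono)
next
  case (4 \<psi> \<chi>)
  then have prems: "free_vars \<psi> \<subseteq> V" "free_vars \<chi> \<subseteq> V" "sat M X \<psi>" "sat M X \<chi>"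
    by simp_all
  have card: "Card_order (height \<psi> :: 'k rel)" "Card_order (height \<chi> :: 'k rel)"
    by (rule Card_order_height[OF bounded 4(1)], assumption)
      (rule Card_order_height[OF bounded 4(2)])
  note IH = 4(3)[OF 4(5) prems(1,3)] 4(4)[OF 4(5) prems(2,4)]
  \<comment> \<open>Conjunction is the case \<open>A = B = X\<close> of
    \<open>small_core_Un\<close>, where intersecting with \<open>X\<close> changes nothing.\<close>
  have "sat M Z (And \<psi> \<chi>)" if "Z \<subseteq> X" "sat M (Z \<inter> X) \<psi> \<and> sat M (Z \<inter> X) \<chi>" for Z
    using that by (simp add: Int_absorb2)
  with small_core_Un[OF card IH]
  show ?case
    unfolding Un_absorb height.simps by (rule small_core_mono)
next
  case (5 \<psi> v)
  obtain H where H: "\<forall>s\<in>X. H s \<noteq> {} \<and> H s \<subseteq> Dom M" "sat M (supplement X H v) \<psi>"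
    using 5(5) unfolding sat.simps by (elim exE conjE) (rule that)
  have "is_team (Dom M) (insert v V) (supplement X H v)"
    using 5(3) by (rule is_team_supplement) (simp add: H(1))
  moreover have "free_vars \<psi> \<subseteq> insert v V"
    using 5(4) by auto
  ultimately have "small_core (height \<psi> :: 'k rel) X (\<lambda>Z. sat M (supplement Z H v) \<psi>)"
    using H(2) by (intro small_core_supplement 5(2))
  \<comment> \<open>The conditions on \<open>H\<close> are pointwise, so the function chosen for
    \<open>X\<close> is still admissible on \<open>Z\<close>.\<close>
  moreover have "sat M Z (Ex v \<psi>)" if "Z \<subseteq> X" "sat M (supplement Z H v) \<psi>" for Z
    unfolding sat.simps using that H(1) by (intro exI[of _ H]) blast
  ultimately show ?case
    unfolding height.simps by (rule small_core_mono)
next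
  case (6 \<psi> v)
  have "is_team (Dom M) (insert v V) (supplement X (\<lambda>_. Dom M) v)"
    using 6(3) by (rule is_team_supplement) simp
  moreover have "free_vars \<psi> \<subseteq> insert v V"
    using 6(4) by auto
  moreover have "sat M (supplement X (\<lambda>_. Dom M) v) \<psi>"
    using 6(5) by (simp add: duplicate_eq_supplement)
  ultimately have
    "small_core (height \<psi> :: 'k rel) X (\<lambda>Z. sat M (supplement Z (\<lambda>_. Dom M) v) \<psi>)"
    by (intro small_core_supplement 6(2))
  then show ?case
    by (simp add: duplicate_eq_supplement)
qed

theorem theorem6p3:
  fixes \<D> :: "'u dependency set"
    and \<phi> :: "('f, 'p, 'u) formula"
    and M :: "('f, 'p, 'u) model"
    and V :: "nat set"
    and X :: "'u assignment set"
  assumes "\<And>D. D \<in> \<D> \<Longrightarrow> is_dependency D"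
    and "\<And>D. D \<in> \<D> \<Longrightarrow> bounded TYPE('k::infinite) D"
    and "\<And>D. D \<in> \<D> \<Longrightarrow> upwards_closed D"
    and "\<phi> \<in> FO \<D>"
    and "is_model M"
    and "is_team (Dom M) V X"
    and "free_vars \<phi> \<subseteq> V"
    and "sat M X \<phi>"
  shows "\<exists>Y\<subseteq>X. |Y| \<le>o (height \<phi> :: 'k rel) \<and> sat M Y \<phi>"
proof -
  have dom: "is_domain (Dom M)"
    using assms(5) unfolding is_model_def by blast
  have "small_core (height \<phi> :: 'k rel) X (\<lambda>Z. sat M Z \<phi>)"
    by (rule small_core_sat[OF assms(2,3) dom assms(4,6-8)])
  then obtain Y where "Y \<subseteq> X" "|Y| \<le>o (height \<phi> :: 'k rel)"
    "\<And>Z. Y \<subseteq> Z \<Longrightarrow> Z \<subseteq> X \<Longrightarrow> sat M Z \<phi>"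
    by (rule small_coreE) (rule that)
  \<comment> \<open>Only the lower end \<open>Z = Y\<close> of the interval is kept.\<close>
  then show ?thesis
    by (intro exI[of _ Y]) simp
qed

end
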